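(* Suppose that a Bratteli diagram is connected and that every vertex has at least two outgoing edges. Then for every edge ordering the set of paths lying in orbits of minimal paths is meager in $X$, and similarly the set of paths lying in orbits of maximal paths is meager in $X$; therefore, for every ordering $\xi$ the set $X(\xi)$ is comeager in $X$.
   Context: A Bratteli diagram is a graded directed graph with vertex set $\mathcal V=\bigsqcup_{n\ge0}\mathcal V_n$ ($\mathcal V_n$ finite nonempty, $\mathcal V_0$ a single vertex, the root) and edge set $\mathcal E=\bigsqcup_{n\ge 0}\mathcal E_n$ ($\mathcal E_n$ finite nonempty), each edge $e\in\mathcal E_n$ having source $s(e)\in\mathcal V_n$ and target $t(e)\in\mathcal V_{n+1}$; every vertex has an outgoing edge, every vertex other than the root has an incoming edge, and multiple edges are allowed. The path space $X$ is the set of infinite paths $x=x_0x_1\dots$, $x_n\in\mathcal E_n$, $t(x_n)=s(x_{n+1})$, starting at the root, with the compact metrizable topology generated by the cylinder sets $\{y: y_0\dots y_n=x_0\dots x_n\}$. Standing assumption: $X$ is homeomorphic to the Cantor set. Two vertices are connected if there is a finite downward directed path of consecutive edges beginning at one of them and ending at the other. The diagram is connected if for every $n$ and every pair $v_1,v_2\in\mathcal V_n$ there are $m>n$ and $w\in\mathcal V_m$ such that $w$ is connected to both $v_1$ and $v_2$. An (edge) ordering is a map $\xi:\mathcal E\to\mathbb N$ which, for each vertex $w$ other than the root, restricts to a bijection from $t^{-1}\{w\}$ onto $\{1,\dots,|t^{-1}\{w\}|\}$. A path is minimal (maximal) if all its edges are minimal (maximal) among the edges entering their targets. The orbit of a path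 $x$ is the set of all paths $y$ tail equivalent to $x$, i.e. $x_n=y_n$ for all sufficiently large $n$. $X'_\xi$ is the set of paths whose edges are all eventually minimal or all eventually maximal (the union of the orbits of minimal and of maximal paths), and $X(\xi)$ is the set of paths that have a dense orbit in $X$ and are not in $X'_\xi$. A set is meager if it is a countable union of nowhere dense sets, and comeager if its complement is meager. *)

theory Defs
  imports "HOL-Analysis.Analysis"
begin

section \<open>Bratteli diagrams\<close>

record ('v, 'e) bratteli =
  vertices :: "nat \<Rightarrow> 'v set"
  edges :: "nat \<Rightarrow> 'e set"
  src :: "'e \<Rightarrow> 'v"
  tgt :: "'e \<Rightarrow> 'v"

locale bratteli_diagram =
  fixes B :: "('v, 'e) bratteli"
  assumes disjoint_vertices: "disjoint_family (vertices B)"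
    and disjoint_edges: "disjoint_family (edges B)"
    and finite_vertices: "finite (vertices B n)"
    and nonempty_vertices: "vertices B n \<noteq> {}"
    and finite_edges: "finite (edges B n)"
    and nonempty_edges: "edges B n \<noteq> {}"
    and root: "is_singleton (vertices B 0)"
    and src_in: "e \<in> edges B n \<Longrightarrow> src B e \<in> vertices B n"
    and tgt_in: "e \<in> edges B n \<Longrightarrow> tgt B e \<in> vertices B (Suc n)"
    and has_outgoing: "v \<in> vertices B n \<Longrightarrow> \<exists>e\<in>edges B n. src B e = v"
    and has_incoming: "w \<in> vertices B (Suc n) \<Longrightarrow> \<exists>e\<in>edges B n. tgt B e = w"

definition all_edges :: "('v, 'e) bratteli \<Rightarrow> 'e set" where
  "all_edges B = (\<Union>n. edges B n)"

definition all_vertices :: "('v, 'e) bratteli \<Rightarrow> 'v set" where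
  "all_vertices B = (\<Union>n. vertices B n)"

definition outgoing :: "('v, 'e) bratteli \<Rightarrow> 'v \<Rightarrow> 'e set" where
  "outgoing B v = {e \<in> all_edges B. src B e = v}"

definition incoming :: "('v, 'e) bratteli \<Rightarrow> 'v \<Rightarrow> 'e set" where
  "incoming B w = {e \<in> all_edges B. tgt B e = w}"

fun downward_path :: "('v, 'e) bratteli \<Rightarrow> 'v \<Rightarrow> 'e list \<Rightarrow> 'v \<Rightarrow> bool" where
  "downward_path B v [] w \<longleftrightarrow> v = w"
| "downward_path B v (e # p) w \<longleftrightarrow> e \<in> outgoing B v \<and> downward_path B (tgt B e) p w"

text \<open>The empty path is admitted, so a vertex is connected to itself; this has no bearing on
  connectedness of the diagram, where the two vertices lie on different levels.\<close>
definition connected_vertices :: "('v, 'e) bratteli \<Rightarrow> 'v \<Rightarrow> 'v \<Rightarrow> bool" where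
  "connected_vertices B v w \<longleftrightarrow> (\<exists>p. downward_path B v p w) \<or> (\<exists>p. downward_path B w p v)"

definition connected_diagram :: "('v, 'e) bratteli \<Rightarrow> bool" where
  "connected_diagram B \<longleftrightarrow>
    (\<forall>n. \<forall>v\<^sub>1\<in>vertices B n. \<forall>v\<^sub>2\<in>vertices B n.
      \<exists>m>n. \<exists>w\<in>vertices B m. connected_vertices B w v\<^sub>1 \<and> connected_vertices B w v\<^sub>2)"


section \<open>The path space\<close>

definition path_space :: "('v, 'e) bratteli \<Rightarrow> (nat \<Rightarrow> 'e) set" where
  "path_space B =
    {x. src B (x 0) \<in> vertices B 0 \<and> (\<forall>n. x n \<in> edges B n \<and> tgt B (x n) = src B (x (Suc n)))}"

definition cylinder :: "('v, 'e) bratteli \<Rightarrow> (nat \<Rightarrow> 'e) \<Rightarrow> nat \<Rightarrow> (nat \<Rightarrow> 'e) set" where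
  "cylinder B x n = {y \<in> path_space B. \<forall>i\<le>n. y i = x i}"

definition path_topology :: "('v, 'e) bratteli \<Rightarrow> (nat \<Rightarrow> 'e) topology" where
  "path_topology B = topology_generated_by {cylinder B x n | x n. x \<in> path_space B}"

lemma topspace_path_topology: "topspace (path_topology B) = path_space B"
  by (auto simp: path_topology_def cylinder_def)

text \<open>The middle-thirds set: the reals in the unit interval having a ternary expansion that
  avoids the digit 1.\<close>
definition cantor_set :: "real set" where
  "cantor_set = {\<Sum>n. real (a n) / 3 ^ Suc n | a :: nat \<Rightarrow> nat. range a \<subseteq> {0, 2}}"

definition orbit :: "('v, 'e) bratteli \<Rightarrow> (nat \<Rightarrow> 'e) \<Rightarrow> (nat \<Rightarrow> 'e) set" where
  "orbit B x = {y \<in> path_space B. \<forall>\<^sub>F n in sequentially. x n = y n}"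


section \<open>Orderings\<close>

text \<open>Only the values of \<open>\<xi>\<close> on the edges of the diagram matter.\<close>
definition edge_ordering :: "('v, 'e) bratteli \<Rightarrow> ('e \<Rightarrow> nat) \<Rightarrow> bool" where
  "edge_ordering B \<xi> \<longleftrightarrow>
    (\<forall>w \<in> all_vertices B - vertices B 0. bij_betw \<xi> (incoming B w) {1..card (incoming B w)})"

definition minimal_edge :: "('v, 'e) bratteli \<Rightarrow> ('e \<Rightarrow> nat) \<Rightarrow> 'e \<Rightarrow> bool" where
  "minimal_edge B \<xi> e \<longleftrightarrow> (\<forall>f\<in>incoming B (tgt B e). \<xi> e \<le> \<xi> f)"

definition maximal_edge :: "('v, 'e) bratteli \<Rightarrow> ('e \<Rightarrow> nat) \<Rightarrow> 'e \<Rightarrow> bool" where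
  "maximal_edge B \<xi> e \<longleftrightarrow> (\<forall>f\<in>incoming B (tgt B e). \<xi> f \<le> \<xi> e)"

definition minimal_paths :: "('v, 'e) bratteli \<Rightarrow> ('e \<Rightarrow> nat) \<Rightarrow> (nat \<Rightarrow> 'e) set" where
  "minimal_paths B \<xi> = {x \<in> path_space B. \<forall>n. minimal_edge B \<xi> (x n)}"

definition maximal_paths :: "('v, 'e) bratteli \<Rightarrow> ('e \<Rightarrow> nat) \<Rightarrow> (nat \<Rightarrow> 'e) set" where
  "maximal_paths B \<xi> = {x \<in> path_space B. \<forall>n. maximal_edge B \<xi> (x n)}"

text \<open>This is \<open>X'\<^sub>\<xi>\<close>. Since every vertex other than the root has a minimal and a maximal
  incoming edge, it is also the union of the orbits of all minimal and all maximal paths.\<close>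
definition extremal_tail_paths :: "('v, 'e) bratteli \<Rightarrow> ('e \<Rightarrow> nat) \<Rightarrow> (nat \<Rightarrow> 'e) set" where
  "extremal_tail_paths B \<xi> =
    {x \<in> path_space B. (\<forall>\<^sub>F n in sequentially. minimal_edge B \<xi> (x n)) \<or>
                       (\<forall>\<^sub>F n in sequentially. maximal_edge B \<xi> (x n))}"

text \<open>This is \<open>X(\<xi>)\<close>.\<close>
definition regular_paths :: "('v, 'e) bratteli \<Rightarrow> ('e \<Rightarrow> nat) \<Rightarrow> (nat \<Rightarrow> 'e) set" where
  "regular_paths B \<xi> =
    {x \<in> path_space B. path_topology B closure_of orbit B x = path_space B} -
      extremal_tail_paths B \<xi>"


section \<open>Baire category\<close>

definition nowhere_dense_in :: "'a topology \<Rightarrow> 'a set \<Rightarrow> bool" where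
  "nowhere_dense_in T A \<longleftrightarrow> A \<subseteq> topspace T \<and> T interior_of (T closure_of A) = {}"

definition meager_in :: "'a topology \<Rightarrow> 'a set \<Rightarrow> bool" where
  "meager_in T S \<longleftrightarrow> (\<exists>\<A>. countable \<A> \<and> (\<forall>A\<in>\<A>. nowhere_dense_in T A) \<and> S = \<Union>\<A>)"

definition comeager_in :: "'a topology \<Rightarrow> 'a set \<Rightarrow> bool" where
  "comeager_in T S \<longleftrightarrow> S \<subseteq> topspace T \<and> meager_in T (topspace T - S)"

end

theory Submission
  imports Defs
begin

text \<open>
  All three claims reduce to one criterion (\<open>nowhere_dense_inI\<close>): a set \<open>S\<close> of paths is nowhere
  dense as soon as every cylinder contains a smaller cylinder disjoint from \<open>S\<close>.

  \<^emph>\<open>Extremal tails.\<close> A vertex has at most one minimal incoming edge. Hence a finite downward path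
  all of whose edges are minimal is determined by its endpoint and its length, since it can be read
  off backwards (\<open>downward_path_unique\<close>). Suppose that every path in some cylinder were minimal from
  level \<open>k\<close> on. The last vertex of a long enough initial segment has two distinct outgoing edges;
  by connectedness the two can be prolonged to a common vertex \<open>w\<close>, which yields two distinct
  minimal paths of the same length ending at \<open>w\<close>. So the paths that are minimal from level \<open>k\<close> on
  form a nowhere dense set, and taking the union over \<open>k\<close> gives a meager set. Only the uniqueness
  matters, so that the argument is carried out for an arbitrary set of edges with at most one edge
  into each vertex (\<open>meager_eventually\<close>) and covers maximal edges as well.

  \<^emph>\<open>Dense orbits.\<close> Fix a cylinder \<open>C\<close>. Any other cylinder and \<open>C\<close> can both be prolonged to finite
  paths ending at a common vertex; every path that follows the former has an orbit which meets \<open>C\<close>,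
  because its initial segment can be exchanged. So the paths whose orbits miss \<open>C\<close> form a nowhere
  dense set (\<open>nowhere_dense_orbit_misses\<close>). As there are only countably many cylinders, the paths
  without a dense orbit form a meager set.
\<close>

section \<open>Meager sets\<close>

lemma meager_in_mono:
  assumes "meager_in T S" "R \<subseteq> S"
  shows "meager_in T R"
proof -
  from assms obtain \<A> where \<A>: "countable \<A>" "\<forall>A\<in>\<A>. nowhere_dense_in T A" "S = \<Union>\<A>"
    by (auto simp: meager_in_def)
  have "nowhere_dense_in T (A \<inter> R)" if "A \<in> \<A>" for A
  proof -
    have "T interior_of (T closure_of (A \<inter> R)) \<subseteq> T interior_of (T closure_of A)"
      by (intro interior_of_mono closure_of_mono) auto
    then show ?thesis
      using \<A>(2) that by (auto simp: nowhere_dense_in_def)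
  qed
  moreover have "R = \<Union>((\<lambda>A. A \<inter> R) ` \<A>)"
    using assms(2) \<A>(3) by auto
  ultimately show ?thesis
    using \<A>(1) unfolding meager_in_def
    by (intro exI[of _ "(\<lambda>A. A \<inter> R) ` \<A>"]) auto
qed

lemma meager_in_UN_nowhere_dense:
  assumes "countable I" "\<And>i. i \<in> I \<Longrightarrow> nowhere_dense_in T (A i)"
  shows "meager_in T (\<Union>i\<in>I. A i)"
  unfolding meager_in_def using assms by (intro exI[of _ "A ` I"]) auto

lemma meager_in_Un:
  assumes "meager_in T R" "meager_in T S"
  shows "meager_in T (R \<union> S)"
proof -
  from assms obtain \<A> \<B> where "countable \<A>" "\<forall>A\<in>\<A>. nowhere_dense_in T A" "R = \<Union>\<A>"
    "countable \<B>" "\<forall>A\<in>\<B>. nowhere_dense_in T A" "S = \<Union>\<B>"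
    by (auto simp: meager_in_def)
  then show ?thesis
    unfolding meager_in_def by (intro exI[of _ "\<A> \<union> \<B>"]) auto
qed


section \<open>Cylinders as a base of the path topology\<close>

lemma openin_cylinder: "x \<in> path_space B \<Longrightarrow> openin (path_topology B) (cylinder B x n)"
  unfolding path_topology_def by (intro topology_generated_by_Basis) auto

lemma cylinder_refl: "x \<in> path_space B \<Longrightarrow> x \<in> cylinder B x n"
  by (auto simp: cylinder_def)

lemma cylinder_subset_openin:
  assumes "openin (path_topology B) U" "x \<in> U"
  shows "\<exists>n. cylinder B x n \<subseteq> U"
proof -
  have "generate_topology_on {cylinder B x n | x n. x \<in> path_space B} U"
    using assms(1) by (simp add: path_topology_def openin_topology_generated_by_iff)
  then show ?thesis
    using assms(2)
  proof induction
    case (Int U V)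
    then obtain m n where "cylinder B x m \<subseteq> U" "cylinder B x n \<subseteq> V"
      by auto
    then have "cylinder B x (max m n) \<subseteq> U \<inter> V"
      by (auto simp: cylinder_def)
    then show ?case
      by blast
  next
    case (UN K)
    then show ?case
      by (meson Union_iff Union_upper subset_trans)
  next
    case (Basis C)
    then obtain y n where "C = cylinder B y n"
      by auto
    then have "cylinder B x n \<subseteq> C"
      using Basis.prems by (auto simp: cylinder_def)
    then show ?case
      by blast
  qed auto
qed

lemma nowhere_dense_inI:
  assumes "S \<subseteq> path_space B"
    and "\<And>x n. x \<in> path_space B \<Longrightarrow> \<exists>y m. y \<in> cylinder B x n \<and> cylinder B y m \<inter> S = {}"
  shows "nowhere_dense_in (path_topology B) S"
proof -
  let ?T = "path_topology B"
  have False if x: "x \<in> ?T interior_of (?T closure_of S)" for x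
  proof -
    obtain n where n: "cylinder B x n \<subseteq> ?T interior_of (?T closure_of S)"
      using cylinder_subset_openin[OF openin_interior_of x] by blast
    have "x \<in> path_space B"
      using x interior_of_subset_topspace[of ?T] by (auto simp: topspace_path_topology)
    then obtain y m where y: "y \<in> cylinder B x n" "cylinder B y m \<inter> S = {}"
      using assms(2) by blast
    have "y \<in> ?T closure_of S"
      using y(1) n interior_of_subset[of ?T "?T closure_of S"] by auto
    moreover have "y \<in> path_space B"
      using y(1) by (simp add: cylinder_def)
    ultimately show False
      using y(2) openin_cylinder[of y B m] cylinder_refl[of y B m] unfolding in_closure_of by blast
  qed
  then show ?thesis
    using assms(1) by (auto simp: nowhere_dense_in_def topspace_path_topology)
qed

lemma not_dense_misses_cylinder:
  assumes "S \<subseteq> path_space B" "path_topology B closure_of S \<noteq> path_space B"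
  shows "\<exists>x\<in>path_space B. \<exists>n. S \<inter> cylinder B x n = {}"
proof -
  have "path_topology B closure_of S \<subseteq> path_space B"
    using closure_of_subset_topspace[of "path_topology B" S] by (simp add: topspace_path_topology)
  then obtain x where x: "x \<in> path_space B" "x \<notin> path_topology B closure_of S"
    using assms(2) by blast
  then obtain U where U: "openin (path_topology B) U" "x \<in> U" "S \<inter> U = {}"
    by (auto simp: in_closure_of topspace_path_topology)
  then show ?thesis
    using cylinder_subset_openin[OF U(1,2)] x(1) by blast
qed


section \<open>Finite and infinite paths\<close>

lemma downward_path_append:
  "downward_path B v (p @ q) w \<longleftrightarrow> (\<exists>u. downward_path B v p u \<and> downward_path B u q w)"
  by (induction p arbitrary: v) auto

lemma downward_path_unique:
  assumes unique: "\<And>e f. e \<in> all_edges B \<Longrightarrow> f \<in> all_edges B \<Longrightarrow> P e \<Longrightarrow> P f \<Longrightarrow>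
      tgt B e = tgt B f \<Longrightarrow> e = f"
    and "length p = length q"
    and "downward_path B v p w" "downward_path B v' q w"
    and "\<forall>e\<in>set p. P e" "\<forall>e\<in>set q. P e"
  shows "p = q"
  using assms(2-)
proof (induction p arbitrary: q w rule: rev_induct)
  case (snoc e p)
  then obtain f q' where q: "q = q' @ [f]"
    by (metis length_0_conv rev_exhaust snoc_eq_iff_butlast)
  have e: "e \<in> all_edges B" "tgt B e = w" "downward_path B v p (src B e)"
    using snoc.prems by (auto simp: downward_path_append outgoing_def)
  have f: "f \<in> all_edges B" "tgt B f = w" "downward_path B v' q' (src B f)"
    using snoc.prems by (auto simp: q downward_path_append outgoing_def)
  have "e = f"
    using unique e f snoc.prems by (simp add: q)
  then show ?case
    using snoc.IH[of q' "src B e"] e f snoc.prems by (simp add: q)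
qed auto

lemma path_space_splice:
  assumes "x \<in> path_space B" "y \<in> path_space B" "tgt B (x n) = tgt B (y n)"
  shows "(\<lambda>i. if i \<le> n then x i else y i) \<in> path_space B"
proof -
  let ?s = "\<lambda>i. if i \<le> n then x i else y i"
  have "?s i \<in> edges B i \<and> tgt B (?s i) = src B (?s (Suc i))" for i
    using assms by (cases i n rule: linorder_cases) (simp_all add: path_space_def)
  moreover have "src B (?s 0) \<in> vertices B 0"
    using assms(1) by (simp add: path_space_def)
  ultimately show ?thesis
    unfolding path_space_def by blast
qed

context bratteli_diagram
begin

lemma vertices_eq_level: "v \<in> vertices B m \<Longrightarrow> v \<in> vertices B n \<Longrightarrow> m = n"
  using disjoint_vertices by (auto simp: disjoint_family_on_def)

lemma outgoing_in_edges:
  assumes "e \<in> outgoing B v" "v \<in> vertices B n"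
  shows "e \<in> edges B n"
proof -
  obtain k where k: "e \<in> edges B k" "src B e = v"
    using assms(1) by (auto simp: outgoing_def all_edges_def)
  then have "k = n"
    using src_in assms(2) vertices_eq_level by blast
  then show ?thesis
    using k by simp
qed

lemma downward_path_level:
  "downward_path B v p w \<Longrightarrow> v \<in> vertices B n \<Longrightarrow> w \<in> vertices B (n + length p)"
proof (induction p arbitrary: v n)
  case (Cons e p)
  then have "tgt B e \<in> vertices B (Suc n)"
    using outgoing_in_edges tgt_in by auto
  then show ?case
    using Cons by fastforce
qed auto

lemma path_space_tgt: "x \<in> path_space B \<Longrightarrow> tgt B (x n) \<in> vertices B (Suc n)"
  using tgt_in[of "x n" n] by (simp add: path_space_def)

lemma countable_all_edges: "countable (all_edges B)"
  by (auto simp: all_edges_def intro: countable_finite finite_edges)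

lemma countable_cylinders: "countable {cylinder B x n | x n. x \<in> path_space B}"
proof -
  let ?C = "\<lambda>p. {y \<in> path_space B. \<forall>i<length p. y i = p ! i}"
  have "cylinder B x n \<in> ?C ` lists (all_edges B)" if "x \<in> path_space B" for x n
  proof (rule image_eqI)
    show "cylinder B x n = ?C (map x [0..<Suc n])"
      by (auto simp: cylinder_def less_Suc_eq_le simp del: upt_Suc)
    show "map x [0..<Suc n] \<in> lists (all_edges B)"
      using that unfolding path_space_def all_edges_def by auto blast
  qed
  then show ?thesis
    by (intro countable_subset[OF _ countable_image[OF countable_lists[OF countable_all_edges]]])
      blast
qed

lemma extend_path_by_edge:
  assumes "x \<in> path_space B" "e \<in> outgoing B (tgt B (x n))"
  shows "\<exists>y\<in>cylinder B x n. y (Suc n) = e"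
proof -
  have e: "e \<in> edges B (Suc n)" "src B e = tgt B (x n)"
    using assms outgoing_in_edges path_space_tgt by (auto simp: outgoing_def)
  obtain z where z: "\<And>j. z j \<in> edges B (Suc n + j) \<and> (j = 0 \<longrightarrow> z j = e)"
    "\<And>j. tgt B (z j) = src B (z (Suc j))"
  proof -
    have "\<exists>z. \<forall>j. (z j \<in> edges B (Suc n + j) \<and> (j = 0 \<longrightarrow> z j = e)) \<and>
        tgt B (z j) = src B (z (Suc j))"
    proof (rule dependent_nat_choice)
      show "\<exists>f. f \<in> edges B (Suc n + 0) \<and> (0 = (0::nat) \<longrightarrow> f = e)"
        using e by auto
      show "\<exists>g. (g \<in> edges B (Suc n + Suc j) \<and> (Suc j = 0 \<longrightarrow> g = e)) \<and> tgt B f = src B g"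
        if "f \<in> edges B (Suc n + j) \<and> (j = 0 \<longrightarrow> f = e)" for f j
      proof -
        have "tgt B f \<in> vertices B (Suc n + Suc j)"
          using that tgt_in by auto
        then show ?thesis
          using has_outgoing by (metis nat.distinct(1))
      qed
    qed
    then show thesis
      using that by blast
  qed
  define y where "y = (\<lambda>i. if i \<le> n then x i else z (i - Suc n))"
  have "y i \<in> edges B i \<and> tgt B (y i) = src B (y (Suc i))" for i
  proof (cases i n rule: linorder_cases)
    case less
    then show ?thesis
      using assms(1) by (auto simp: y_def path_space_def)
  next
    case equal
    then show ?thesis
      using assms(1) e z(1)[of 0] by (auto simp: y_def path_space_def)
  next
    case greater
    then show ?thesis
      using z(1)[of "i - Suc n"] z(2)[of "i - Suc n"] by (simp add: y_def Suc_diff_Suc)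
  qed
  moreover have "src B (y 0) \<in> vertices B 0"
    using assms(1) by (auto simp: y_def path_space_def)
  ultimately have "y \<in> cylinder B x n"
    by (auto simp: cylinder_def path_space_def y_def)
  moreover have "y (Suc n) = e"
    using z(1)[of 0] by (simp add: y_def)
  ultimately show ?thesis
    by blast
qed

lemma extend_path:
  assumes "x \<in> path_space B" "downward_path B (tgt B (x n)) p w"
  shows "\<exists>y\<in>cylinder B x n. (\<forall>j<length p. y (Suc n + j) = p ! j) \<and> tgt B (y (n + length p)) = w"
  using assms
proof (induction p arbitrary: x n)
  case Nil
  then show ?case
    by (auto intro!: bexI[of _ x] cylinder_refl)
next
  case (Cons e p)
  then obtain y where y: "y \<in> cylinder B x n" "y (Suc n) = e"
    using extend_path_by_edge[of x e n] by auto
  then have "y \<in> path_space B" "downward_path B (tgt B (y (Suc n))) p w"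
    using Cons.prems by (auto simp: cylinder_def)
  then obtain z where z: "z \<in> cylinder B y (Suc n)" "\<forall>j<length p. z (Suc (Suc n) + j) = p ! j"
      "tgt B (z (Suc n + length p)) = w"
    using Cons.IH by blast
  have "z \<in> cylinder B x n" "z (Suc n) = e"
    using y z(1) by (auto simp: cylinder_def)
  moreover have "z (Suc n + j) = (e # p) ! j" if "j < length (e # p)" for j
    using that z(2) \<open>z (Suc n) = e\<close> by (cases j) auto
  ultimately show ?case
    using z(3) by (intro bexI[of _ z]) auto
qed

lemma connected_vertices_lower:
  assumes "connected_vertices B w v" "v \<in> vertices B n" "w \<in> vertices B m" "n < m"
  shows "\<exists>p. downward_path B v p w \<and> n + length p = m"
proof -
  have "\<not> downward_path B w p v" for p
  proof
    assume "downward_path B w p v"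
    then have "m + length p = n"
      using downward_path_level vertices_eq_level assms by blast
    then show False
      using assms(4) by simp
  qed
  then obtain p where p: "downward_path B v p w"
    using assms(1) by (auto simp: connected_vertices_def)
  then have "n + length p = m"
    using downward_path_level vertices_eq_level assms by blast
  then show ?thesis
    using p by blast
qed

lemma connected_diagramE:
  assumes "connected_diagram B" "v \<in> vertices B n" "v' \<in> vertices B n"
  obtains p q w where "downward_path B v p w" "downward_path B v' q w" "length p = length q"
proof -
  obtain m w where m: "n < m" "w \<in> vertices B m" "connected_vertices B w v"
      "connected_vertices B w v'"
    using assms unfolding connected_diagram_def by blast
  obtain p where p: "downward_path B v p w" "n + length p = m"
    using connected_vertices_lower[of w v n m] m assms by blast
  obtain q where q: "downward_path B v' q w" "n + length q = m"
    using connected_vertices_lower[of w v' n m] m assms by blast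
  show thesis
    using that p q by simp
qed


section \<open>Paths with extremal tails\<close>

text \<open>With \<open>P\<close> being minimality of edges, this covers the orbits of minimal paths; with maximality,
  those of maximal paths.\<close>

lemma meager_eventually:
  assumes connected: "connected_diagram B"
    and two: "\<forall>v\<in>all_vertices B. card (outgoing B v) \<ge> 2"
    and unique: "\<And>e f. e \<in> all_edges B \<Longrightarrow> f \<in> all_edges B \<Longrightarrow> P e \<Longrightarrow> P f \<Longrightarrow>
      tgt B e = tgt B f \<Longrightarrow> e = f"
  shows "meager_in (path_topology B) {x \<in> path_space B. \<forall>\<^sub>F n in sequentially. P (x n)}"
proof -
  have "nowhere_dense_in (path_topology B) {x \<in> path_space B. \<forall>i\<ge>k. P (x i)}" for k
  proof (rule nowhere_dense_inI)
    fix x n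
    assume x: "x \<in> path_space B"
    define N where "N = max n k"
    let ?v = "tgt B (x N)"
    have v: "?v \<in> vertices B (Suc N)"
      by (rule path_space_tgt[OF x])
    then have "card (outgoing B ?v) \<ge> 2"
      using two unfolding all_vertices_def by blast
    then have "finite (outgoing B ?v)" "\<not> card (outgoing B ?v) \<le> Suc 0"
      by (auto intro: card_ge_0_finite)
    then obtain e f where ef: "e \<in> outgoing B ?v" "f \<in> outgoing B ?v" "e \<noteq> f"
      by (auto simp: card_le_Suc0_iff_eq)
    have "tgt B e \<in> vertices B (Suc (Suc N))" "tgt B f \<in> vertices B (Suc (Suc N))"
      using ef outgoing_in_edges[OF _ v] tgt_in by auto
    then obtain p q w where pq: "downward_path B (tgt B e) p w" "downward_path B (tgt B f) q w"
        "length p = length q"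
      using connected_diagramE[OF connected] by metis
    have paths: "downward_path B ?v (e # p) w" "downward_path B ?v (f # q) w"
      using pq ef by auto
    have "\<not> ((\<forall>g\<in>set (e # p). P g) \<and> (\<forall>g\<in>set (f # q). P g))"
    proof
      assume "(\<forall>g\<in>set (e # p). P g) \<and> (\<forall>g\<in>set (f # q). P g)"
      then have "e # p = f # q"
        using pq(3) by (intro downward_path_unique[OF unique _ paths]) auto
      then show False
        using ef(3) by simp
    qed
    then obtain r g where r: "downward_path B ?v r w" "g \<in> set r" "\<not> P g"
      using paths by blast
    then obtain j where j: "j < length r" "r ! j = g"
      by (auto simp: in_set_conv_nth)
    obtain y where y: "y \<in> cylinder B x N" "\<forall>j<length r. y (Suc N + j) = r ! j"
      using extend_path[OF x r(1)] by blast
    then have "\<not> P (u (Suc N + j))" if "u \<in> cylinder B y (Suc N + j)" for u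
      using j r(3) that by (simp add: cylinder_def)
    moreover have "k \<le> Suc N + j"
      by (simp add: N_def)
    ultimately have "cylinder B y (Suc N + j) \<inter> {x \<in> path_space B. \<forall>i\<ge>k. P (x i)} = {}"
      by blast
    moreover have "y \<in> cylinder B x n"
      using y(1) by (auto simp: cylinder_def N_def)
    ultimately show "\<exists>y m. y \<in> cylinder B x n \<and>
        cylinder B y m \<inter> {x \<in> path_space B. \<forall>i\<ge>k. P (x i)} = {}"
      by blast
  qed auto
  then have "meager_in (path_topology B) (\<Union>k. {x \<in> path_space B. \<forall>i\<ge>k. P (x i)})"
    by (intro meager_in_UN_nowhere_dense) auto
  then show ?thesis
    by (rule meager_in_mono) (auto simp: eventually_sequentially)
qed

lemma edge_ordering_inj:
  assumes "edge_ordering B \<xi>" "e \<in> all_edges B" "f \<in> all_edges B"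
    and "tgt B e = tgt B f" "\<xi> e = \<xi> f"
  shows "e = f"
proof -
  obtain n where "tgt B e \<in> vertices B (Suc n)"
    using assms(2) tgt_in by (auto simp: all_edges_def)
  then have "tgt B e \<in> all_vertices B - vertices B 0"
    using vertices_eq_level by (fastforce simp: all_vertices_def)
  then have "inj_on \<xi> (incoming B (tgt B e))"
    using assms(1) by (auto simp: edge_ordering_def bij_betw_def)
  then show ?thesis
    using assms by (auto simp: incoming_def inj_on_def)
qed

lemma minimal_edge_unique:
  assumes "edge_ordering B \<xi>" "e \<in> all_edges B" "f \<in> all_edges B"
    and "minimal_edge B \<xi> e" "minimal_edge B \<xi> f" "tgt B e = tgt B f"
  shows "e = f"
proof (rule edge_ordering_inj)
  show "\<xi> e = \<xi> f"
    using assms by (auto simp: minimal_edge_def incoming_def intro!: antisym)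
qed (use assms in auto)

lemma maximal_edge_unique:
  assumes "edge_ordering B \<xi>" "e \<in> all_edges B" "f \<in> all_edges B"
    and "maximal_edge B \<xi> e" "maximal_edge B \<xi> f" "tgt B e = tgt B f"
  shows "e = f"
proof (rule edge_ordering_inj)
  show "\<xi> e = \<xi> f"
    using assms by (auto simp: maximal_edge_def incoming_def intro!: antisym)
qed (use assms in auto)


section \<open>Paths without a dense orbit\<close>

lemma nowhere_dense_orbit_misses:
  assumes connected: "connected_diagram B" and x: "x \<in> path_space B"
  shows "nowhere_dense_in (path_topology B) {y \<in> path_space B. orbit B y \<inter> cylinder B x n = {}}"
proof (rule nowhere_dense_inI)
  fix x' n'
  assume x': "x' \<in> path_space B"
  define N where "N = max n n'"
  obtain p q w where pq: "downward_path B (tgt B (x N)) p w" "downward_path B (tgt B (x' N)) q w"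
      "length p = length q"
    using connected_diagramE[OF connected path_space_tgt[OF x] path_space_tgt[OF x']] by metis
  define M where "M = N + length p"
  obtain z where z: "z \<in> cylinder B x N" "tgt B (z M) = w"
    using extend_path[OF x pq(1)] by (auto simp: M_def)
  obtain y where y: "y \<in> cylinder B x' N" "tgt B (y M) = w"
    using extend_path[OF x' pq(2)] by (auto simp: M_def pq(3))
  have "orbit B u \<inter> cylinder B x n \<noteq> {}" if u: "u \<in> cylinder B y M" for u
  proof -
    \<comment> \<open>Exchange the initial segment of \<open>u\<close>, which ends at \<open>w\<close>, for that of \<open>z\<close>.\<close>
    let ?s = "\<lambda>i. if i \<le> M then z i else u i"
    have s: "?s \<in> path_space B"
      using z y u by (intro path_space_splice) (auto simp: cylinder_def)
    moreover have "\<forall>\<^sub>F i in sequentially. u i = ?s i"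
      using eventually_gt_at_top[of M] by eventually_elim auto
    moreover have "?s i = x i" if "i \<le> n" for i
      using that z(1) by (auto simp: cylinder_def N_def M_def)
    ultimately have "?s \<in> orbit B u \<inter> cylinder B x n"
      by (auto simp: orbit_def cylinder_def)
    then show ?thesis
      by blast
  qed
  then have "cylinder B y M \<inter> {y \<in> path_space B. orbit B y \<inter> cylinder B x n = {}} = {}"
    by blast
  moreover have "y \<in> cylinder B x' n'"
    using y(1) by (auto simp: cylinder_def N_def)
  ultimately show "\<exists>y m. y \<in> cylinder B x' n' \<and>
      cylinder B y m \<inter> {y \<in> path_space B. orbit B y \<inter> cylinder B x n = {}} = {}"
    by blast
qed auto

lemma meager_not_dense_orbit:
  assumes "connected_diagram B"
  shows "meager_in (path_topology B)
    {y \<in> path_space B. path_topology B closure_of orbit B y \<noteq> path_space B}"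
proof (rule meager_in_mono)
  let ?\<C> = "{cylinder B x n | x n. x \<in> path_space B}"
  show "meager_in (path_topology B) (\<Union>C\<in>?\<C>. {y \<in> path_space B. orbit B y \<inter> C = {}})"
    using nowhere_dense_orbit_misses[OF assms]
    by (intro meager_in_UN_nowhere_dense countable_cylinders) auto
  show "{y \<in> path_space B. path_topology B closure_of orbit B y \<noteq> path_space B}
      \<subseteq> (\<Union>C\<in>?\<C>. {y \<in> path_space B. orbit B y \<inter> C = {}})"
  proof
    fix y
    assume y: "y \<in> {y \<in> path_space B. path_topology B closure_of orbit B y \<noteq> path_space B}"
    then obtain x n where "x \<in> path_space B" "orbit B y \<inter> cylinder B x n = {}"
      using not_dense_misses_cylinder[of "orbit B y" B] by (auto simp: orbit_def)
    then show "y \<in> (\<Union>C\<in>?\<C>. {y \<in> path_space B. orbit B y \<inter> C = {}})"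
      using y by blast
  qed
qed

end

lemma orbits_subset_eventually:
  assumes "\<And>x n. x \<in> S \<Longrightarrow> P (x n)"
  shows "(\<Union>x\<in>S. orbit B x) \<subseteq> {y \<in> path_space B. \<forall>\<^sub>F n in sequentially. P (y n)}"
proof -
  have "\<forall>\<^sub>F n in sequentially. P (y n)" if "x \<in> S" "y \<in> orbit B x" for x y
  proof -
    have "\<forall>\<^sub>F n in sequentially. x n = y n"
      using that by (simp add: orbit_def)
    then show ?thesis
      using assms[OF that(1)] by (auto elim!: eventually_mono) metis
  qed
  then show ?thesis
    by (auto simp: orbit_def)
qed

theorem proposition2p3:
  fixes B :: "('v, 'e) bratteli"
  assumes "bratteli_diagram B"
    and "path_topology B homeomorphic_space top_of_set cantor_set"
    and "connected_diagram B"
    and "\<forall>v\<in>all_vertices B. card (outgoing B v) \<ge> 2"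
  shows "\<forall>\<xi>. edge_ordering B \<xi> \<longrightarrow>
      meager_in (path_topology B) (\<Union>x\<in>minimal_paths B \<xi>. orbit B x) \<and>
      meager_in (path_topology B) (\<Union>x\<in>maximal_paths B \<xi>. orbit B x) \<and>
      comeager_in (path_topology B) (regular_paths B \<xi>)"
proof (intro allI impI conjI)
  fix \<xi>
  assume \<xi>: "edge_ordering B \<xi>"
  interpret bratteli_diagram B
    by (rule assms(1))
  let ?T = "path_topology B"
  let ?min = "{x \<in> path_space B. \<forall>\<^sub>F n in sequentially. minimal_edge B \<xi> (x n)}"
  let ?max = "{x \<in> path_space B. \<forall>\<^sub>F n in sequentially. maximal_edge B \<xi> (x n)}"
  have min: "meager_in ?T ?min"
    by (rule meager_eventually[OF assms(3,4)]) (rule minimal_edge_unique[OF \<xi>])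
  have max: "meager_in ?T ?max"
    by (rule meager_eventually[OF assms(3,4)]) (rule maximal_edge_unique[OF \<xi>])
  show "meager_in ?T (\<Union>x\<in>minimal_paths B \<xi>. orbit B x)"
    by (rule meager_in_mono[OF min orbits_subset_eventually]) (auto simp: minimal_paths_def)
  show "meager_in ?T (\<Union>x\<in>maximal_paths B \<xi>. orbit B x)"
    by (rule meager_in_mono[OF max orbits_subset_eventually]) (auto simp: maximal_paths_def)
  have "meager_in ?T (path_space B - regular_paths B \<xi>)"
    by (rule meager_in_mono[OF meager_in_Un[OF meager_not_dense_orbit[OF assms(3)]
          meager_in_Un[OF min max]]])
      (auto simp: regular_paths_def extremal_tail_paths_def)
  then show "comeager_in ?T (regular_paths B \<xi>)"
    by (auto simp: comeager_in_def topspace_path_topology regular_paths_def)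
qed

end
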